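(* For any (orientable) join-prime ribbon graph $G$ different from the partial duals of the $B_n$'s with odd values of $n$, there are partial duals of different genus, i.e. there exist subsets $A,A'\subseteq E(G)$ with $g(G^{A})\neq g(G^{A'})$.
   Context: All ribbon graphs are orientable. A ribbon graph $G$ is a surface with boundary represented as the union of two sets of closed topological discs, vertex-discs $V(G)$ and edge-ribbons $E(G)$, such that: vertex-discs and edge-ribbons intersect in disjoint line segments; each such segment lies on the boundary of precisely one vertex-disc and precisely one edge-ribbon; every edge-ribbon contains exactly two such segments. (So each edge-ribbon is a rectangle attached to vertex-discs along two opposite sides.) Gluing a disc (face-disc) to each boundary component gives a closed surface $\Sigma_G$; the genus $g(G)$ is the orientable genus of $\Sigma_G$, so for connected $G$ one has $2-2g(G)=|V(G)|-|E(G)|+(\text{number of face-discs})$. Partial dual: for $A\subseteq E(G)$, the partial dual $G^A$ is the ribbon graph whose vertex-discs are discs bounded by the boundary components of the spanning ribbon subgraph of $G$ with all vertices of $G$ and only the edges in $A$. Edge-ribbons in $E(G)\setminus A$ are attached to these new vertex-discs at exactly the same places as in $G$. For $e\in A$, a copy $e'$ of the rectangle $e$ is attached to the new vertex-discs along the pair of opposite sides of $e$ by which $e$ was not attached to vertex-discs of $G$ (these sides are arcs of the boundary of the spanning subgraph); the copies of the other pair of sides become arcs of the boundary of $G^A$. Ribbon-join: $G_1\vee G_2$ denotes any ribbon graph obtained from ribbon graphs $G_1,G_2$ by gluing a vertex-disc of $G_1$ to a vertex-disc of $G_2$ along an arc of the boundary of each, each arc lying between consecutive ends of edge-ribbons,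 so that the two vertex-discs become one vertex-disc. The result depends on the choice of vertex-discs and arcs. A connected ribbon graph $G$ is join-prime if it cannot be represented as a ribbon-join $G_1\vee G_2$ of two ribbon graphs each having at least one edge-ribbon. $B_n$ is the one-vertex orientable ribbon graph with $n$ edge-ribbons every two of which are interlaced, i.e. their ends alternate along the boundary circle of the vertex-disc. A partial dual of $B_n$ is a ribbon graph $B_n^{A}$ with $A\subseteq E(B_n)$.
   Formalization: The ribbon graph G is additionally required to have at least one edge-ribbon; the single vertex-disc without edge-ribbons is join-prime as defined, but has only one partial dual, so the claim fails for it. *)

theory Defs
  imports "HOL-Combinatorics.Orbits" "HOL-Combinatorics.Transposition"
begin

text \<open>
  An orientable ribbon graph is encoded, up to homeomorphism, by its rotation system.
  A dart is a segment along which an edge-ribbon is attached to a vertex-disc. After an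
  orientation of the surface is chosen, \<open>rot\<close> sends a dart to the next one along the boundary
  circle of its vertex-disc, and \<open>flip\<close> exchanges the two darts of an edge-ribbon. Vertex-discs
  to which no edge-ribbon is attached carry no dart and are only counted, by \<open>isolated\<close>.
\<close>

record 'd rgraph =
  darts :: "'d set"
  rot :: "'d \<Rightarrow> 'd"
  flip :: "'d \<Rightarrow> 'd"
  isolated :: nat

definition ribbon_graph :: "'d rgraph \<Rightarrow> bool" where
  "ribbon_graph G \<longleftrightarrow> finite (darts G) \<and> rot G permutes darts G \<and> flip G permutes darts G \<and>
     (\<forall>d\<in>darts G. flip G d \<noteq> d \<and> flip G (flip G d) = d)"

definition edges :: "'d rgraph \<Rightarrow> 'd set set" where
  "edges G = (\<lambda>d. {d, flip G d}) ` darts G"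

definition num_vertices :: "'d rgraph \<Rightarrow> nat" where
  "num_vertices G = card (orbit (rot G) ` darts G) + isolated G"

definition num_components :: "'d rgraph \<Rightarrow> nat" where
  "num_components G =
     card ((\<lambda>d. {d'. (d, d') \<in> ({(x, rot G x) | x. x \<in> darts G} \<union> {(x, flip G x) | x. x \<in> darts G})\<^sup>*})
            ` darts G) + isolated G"

definition connected_rg :: "'d rgraph \<Rightarrow> bool" where
  "connected_rg G \<longleftrightarrow> num_components G = 1"

text \<open>
  The boundary walk of the spanning ribbon subgraph with edge set \<open>A\<close>, recorded at the darts
  of \<open>G\<close>. At the end \<open>d\<close> of an edge-ribbon outside \<open>A\<close> it continues along the same vertex-disc
  to \<open>rot G d\<close>. At the end \<open>d\<close> of an edge-ribbon in \<open>A\<close> it turns off along the side of this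
  ribbon leading to the far corner of the other end \<open>flip G d\<close>, and continues to
  \<open>rot G (flip G d)\<close>.
  So for an edge-ribbon in \<open>A\<close> the dart \<open>d\<close> stands for the free side that the walk enters at \<open>d\<close>.
\<close>

definition boundary_walk :: "'d rgraph \<Rightarrow> 'd set set \<Rightarrow> 'd \<Rightarrow> 'd" where
  "boundary_walk G A d = (if d \<in> \<Union>A then rot G (flip G d) else rot G d)"

definition num_boundary :: "'d rgraph \<Rightarrow> 'd set set \<Rightarrow> nat" where
  "num_boundary G A = card (orbit (boundary_walk G A) ` darts G) + isolated G"

text \<open>
  The vertex-discs of the partial dual are bounded by the boundary components of the spanning
  subgraph. Edge-ribbons outside \<open>A\<close> keep their ends. An edge-ribbon in \<open>A\<close> is attached along
  its two free sides, which the walk enters at \<open>d\<close> and at \<open>flip G d\<close>; hence \<open>flip\<close> is unchanged.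
\<close>

definition partial_dual :: "'d rgraph \<Rightarrow> 'd set set \<Rightarrow> 'd rgraph" where
  "partial_dual G A = G\<lparr>rot := boundary_walk G A\<rparr>"

definition euler_char :: "'d rgraph \<Rightarrow> int" where
  "euler_char G =
     int (num_vertices G) - int (card (edges G)) + int (num_boundary G (edges G))"

text \<open>
  From \<open>2 c - 2 g = euler_char G\<close>, where \<open>c\<close> is the number of components; the genus of a
  disconnected surface is the sum of the genera of its components. The division is exact.
\<close>

definition genus :: "'d rgraph \<Rightarrow> int" where
  "genus G = (2 * int (num_components G) - euler_char G) div 2"

text \<open>
  Homeomorphism of ribbon graphs, not assumed to preserve the chosen orientations: \<open>S\<close> is the
  union of those components on which the orientation is reversed.
\<close>

definition ribbon_iso :: "'d rgraph \<Rightarrow> 'e rgraph \<Rightarrow> bool" where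
  "ribbon_iso G H \<longleftrightarrow> isolated G = isolated H \<and>
     (\<exists>f S. bij_betw f (darts G) (darts H) \<and> S \<subseteq> darts G \<and>
        (\<forall>d\<in>darts G. (rot G d \<in> S \<longleftrightarrow> d \<in> S) \<and> (flip G d \<in> S \<longleftrightarrow> d \<in> S)) \<and>
        (\<forall>d\<in>darts G. f (flip G d) = flip H (f d)) \<and>
        (\<forall>d\<in>darts G - S. f (rot G d) = rot H (f d)) \<and>
        (\<forall>d\<in>S. rot H (f (rot G d)) = f d))"

text \<open>
  The ribbon-joins of \<open>G1\<close> and \<open>G2\<close>. In the first rule the gluing arcs lie between \<open>d1\<close> and
  \<open>rot G1 d1\<close> and between \<open>d2\<close> and \<open>rot G2 d2\<close>, so that \<open>d1\<close> is followed by \<open>rot G2 d2\<close> and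
  \<open>d2\<close> by \<open>rot G1 d1\<close>. In the others one of the two glued vertex-discs carries no edge-ribbon,
  and the other one is arbitrary. Rotations are the identity off the darts, whence the
  compositions.
\<close>

inductive ribbon_join :: "'d rgraph \<Rightarrow> 'd rgraph \<Rightarrow> 'd rgraph \<Rightarrow> bool"
  for G1 G2 :: "'d rgraph" where
  at_arcs: "darts G1 \<inter> darts G2 = {} \<Longrightarrow> d1 \<in> darts G1 \<Longrightarrow> d2 \<in> darts G2 \<Longrightarrow>
    ribbon_join G1 G2
      \<lparr>darts = darts G1 \<union> darts G2,
       rot = rot G1 \<circ> rot G2 \<circ> transpose d1 d2,
       flip = flip G1 \<circ> flip G2,
       isolated = isolated G1 + isolated G2\<rparr>"
| at_isolated_left: "darts G1 \<inter> darts G2 = {} \<Longrightarrow> isolated G1 > 0 \<Longrightarrow> num_vertices G2 > 0 \<Longrightarrow>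
    ribbon_join G1 G2
      \<lparr>darts = darts G1 \<union> darts G2,
       rot = rot G1 \<circ> rot G2,
       flip = flip G1 \<circ> flip G2,
       isolated = isolated G1 + isolated G2 - 1\<rparr>"
| at_isolated_right: "darts G1 \<inter> darts G2 = {} \<Longrightarrow> num_vertices G1 > 0 \<Longrightarrow> isolated G2 > 0 \<Longrightarrow>
    ribbon_join G1 G2
      \<lparr>darts = darts G1 \<union> darts G2,
       rot = rot G1 \<circ> rot G2,
       flip = flip G1 \<circ> flip G2,
       isolated = isolated G1 + isolated G2 - 1\<rparr>"

text \<open>
  Using the same dart type for all graphs loses no generality: a join homeomorphic to \<open>G\<close> can
  be relabelled by the darts of \<open>G\<close>.
\<close>

definition join_prime :: "'d rgraph \<Rightarrow> bool" where
  "join_prime G \<longleftrightarrow> connected_rg G \<and>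
     \<not> (\<exists>(G1 :: 'd rgraph) (G2 :: 'd rgraph) (H :: 'd rgraph).
          ribbon_graph G1 \<and> ribbon_graph G2 \<and> edges G1 \<noteq> {} \<and> edges G2 \<noteq> {} \<and>
          ribbon_join G1 G2 H \<and> ribbon_iso G H)"

definition interlaced :: "'d rgraph \<Rightarrow> 'd set \<Rightarrow> 'd set \<Rightarrow> bool" where
  "interlaced G e e' \<longleftrightarrow>
     (\<exists>a\<in>e. \<exists>b\<in>e'. \<exists>i j k. 0 < i \<and> i < j \<and> j < k \<and> k < card (orbit (rot G) a) \<and>
        (rot G ^^ i) a = b \<and> (rot G ^^ j) a = flip G a \<and> (rot G ^^ k) a = flip G b)"

definition is_B :: "nat \<Rightarrow> 'd rgraph \<Rightarrow> bool" where
  "is_B n G \<longleftrightarrow> ribbon_graph G \<and> num_vertices G = 1 \<and> card (edges G) = n \<and>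
     (\<forall>e\<in>edges G. \<forall>e'\<in>edges G. e \<noteq> e' \<longrightarrow> interlaced G e e')"

lemma edges_partial_dual: "edges (partial_dual G A) = edges G"
  by (simp add: edges_def partial_dual_def)

lemma ribbon_graph_partial_dual:
  assumes G: "ribbon_graph G" and A: "A \<subseteq> edges G"
  shows "ribbon_graph (partial_dual G A)"
proof -
  have rot: "rot G permutes darts G" and flip: "flip G permutes darts G"
    and inv: "\<And>d. d \<in> darts G \<Longrightarrow> flip G (flip G d) = d"
    using G by (auto simp: ribbon_graph_def)
  define p where "p d = (if d \<in> \<Union>A then flip G d else d)" for d
  have "e \<subseteq> darts G" if "e \<in> edges G" for e
    using that permutes_in_image[OF flip] unfolding edges_def by auto
  then have sub: "\<Union>A \<subseteq> darts G"
    using A by blast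
  have mem: "flip G d \<in> \<Union>A" if d: "d \<in> \<Union>A" for d
  proof -
    obtain e where e: "e \<in> A" "d \<in> e" using d by blast
    then obtain x where x: "x \<in> darts G" "e = {x, flip G x}"
      using A unfolding edges_def by blast
    have "flip G d \<in> e" using e(2) x inv[OF x(1)] by auto
    with e(1) show ?thesis by blast
  qed
  have pp: "p (p d) = d" for d
  proof (cases "d \<in> \<Union>A")
    case True
    then have "d \<in> darts G" using sub by (rule set_mp[rotated])
    then show ?thesis using True mem[OF True] inv unfolding p_def by presburger
  qed (simp only: p_def if_False)
  have "p permutes darts G"
    unfolding permutes_def
  proof (intro conjI allI impI)
    fix x assume "x \<notin> darts G"
    then have "x \<notin> \<Union>A" using sub by blast
    then show "p x = x" by (simp only: p_def if_False)
  next
    fix y show "\<exists>!x. p x = y"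
      by (rule ex1I[of _ "p y"]) (use pp in metis)+
  qed
  moreover have "boundary_walk G A = rot G \<circ> p"
    unfolding boundary_walk_def p_def by (rule ext) (simp only: o_apply split: if_split, simp)
  ultimately have "boundary_walk G A permutes darts G"
    using rot by (simp add: permutes_compose)
  with G show ?thesis
    by (auto simp: ribbon_graph_def partial_dual_def)
qed

end

theory Submission
  imports Defs
begin

text \<open>
  Write \<open>b A\<close> for the number of boundary components of the spanning subgraph with edge set
  \<open>A\<close>. The genus of the partial dual by \<open>A\<close> is an affine function of \<open>b A + b (E - A)\<close>, so if
  all partial duals have the same genus, this sum is constant. Dualising along a set \<open>A\<close> with
  \<open>b A = 1\<close> we may assume that there is a single vertex. Then no edge has the same face on both
  of its sides, and two edges are interlaced iff they separate the same two faces. Hence being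
  interlaced or equal is an equivalence relation. If it has several classes, then an arc of the
  vertex circle between consecutive ends of edges of one class contains, with one end of an edge,
  also the other, and the graph is a ribbon-join. Otherwise all edges are interlaced, there are
  exactly two faces, and the number of edges is odd by parity.
\<close>

subsection \<open>Orbits of permutations\<close>

lemma orbit_eq_iff:
  assumes "permutation p"
  shows "orbit p a = orbit p b \<longleftrightarrow> b \<in> orbit p a"
  by (metis assms cyclic_on_orbit' orbit_cyclic_eq3 permutation_self_in_orbit)

lemma orbit_enumerate:
  assumes "permutation p"
  shows "inj_on (\<lambda>t. (p ^^ t) x) {..<card (orbit p x)}"
    and "orbit p x = (\<lambda>t. (p ^^ t) x) ` {..<card (orbit p x)}"
    and "(p ^^ card (orbit p x)) x = x"
proof -
  let ?N = "funpow_dist1 p x x"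
  have x: "x \<in> orbit p x"
    using assms by (rule permutation_self_in_orbit)
  have inj: "inj_on (\<lambda>t. (p ^^ t) x) {..<?N}"
    using inj_on_funpow_dist1[OF x] by (simp add: lessThan_atLeast0)
  have orb: "orbit p x = (\<lambda>t. (p ^^ t) x) ` {..<?N}"
    using orbit_conv_funpow_dist1[OF x] by (simp add: lessThan_atLeast0)
  have "card (orbit p x) = ?N"
    by (subst orb) (simp add: card_image[OF inj])
  with inj orb funpow_dist1_prop[OF x]
  show "inj_on (\<lambda>t. (p ^^ t) x) {..<card (orbit p x)}"
    and "orbit p x = (\<lambda>t. (p ^^ t) x) ` {..<card (orbit p x)}"
    and "(p ^^ card (orbit p x)) x = x"
    by metis+
qed

lemma orbit_subset_invariant:
  assumes "x \<in> K" "\<And>y. y \<in> K \<Longrightarrow> p y \<in> K"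
  shows "orbit p x \<subseteq> K"
proof
  fix y assume "y \<in> orbit p x"
  then show "y \<in> K" by induction (use assms in auto)
qed

text \<open>Precomposing with the transposition short-circuits the cycle: position \<open>r\<close>
  is now followed by position \<open>l + 1\<close>, so the positions after \<open>l\<close> up to
  \<open>r\<close> close up. Splitting orbits, cutting off a join summand and reading off
  interlacement all rest on this.\<close>

lemma arc_invariant:
  assumes inj: "inj_on (\<lambda>t. (p ^^ t) x) {..<N}" and lr: "l < r" "r < N"
    and y: "y \<in> (\<lambda>t. (p ^^ t) x) ` {l<..r}"
  shows "(p \<circ> transpose ((p ^^ l) x) ((p ^^ r) x)) y \<in> (\<lambda>t. (p ^^ t) x) ` {l<..r}"
proof -
  obtain t where t: "l < t" "t \<le> r" "y = (p ^^ t) x"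
    using y by auto
  have "y \<noteq> (p ^^ l) x"
    using inj_onD[OF inj, of t l] t lr by auto
  show ?thesis
  proof (cases "t = r")
    case True
    then have "(p \<circ> transpose ((p ^^ l) x) ((p ^^ r) x)) y = (p ^^ Suc l) x"
      using t by simp
    moreover have "Suc l \<in> {l<..r}"
      using lr by simp
    ultimately show ?thesis
      by blast
  next
    case False
    then have "y \<noteq> (p ^^ r) x"
      using inj_onD[OF inj, of t r] t lr by auto
    then have "(p \<circ> transpose ((p ^^ l) x) ((p ^^ r) x)) y = (p ^^ Suc t) x"
      using t \<open>y \<noteq> (p ^^ l) x\<close> by simp
    moreover have "Suc t \<in> {l<..r}"
      using t False by simp
    ultimately show ?thesis
      by blast
  qed
qed

lemma arc_notin:
  fixes t :: nat
  assumes "inj_on (\<lambda>t. (p ^^ t) x) {..<N}" "r < N" "t < N" "t \<notin> {l<..r}"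
  shows "(p ^^ t) x \<notin> (\<lambda>t. (p ^^ t) x) ` {l<..r}"
proof
  assume "(p ^^ t) x \<in> (\<lambda>t. (p ^^ t) x) ` {l<..r}"
  then obtain u where "u \<in> {l<..r}" "(p ^^ t) x = (p ^^ u) x"
    by auto
  with assms show False
    using inj_onD[OF assms(1), of t u] by auto
qed

lemma permutation_comp_transpose:
  "permutation p \<Longrightarrow> permutation (p \<circ> transpose a b)"
  by (simp add: permutation_compose permutation_swap_id)

text \<open>The arc after \<open>a\<close> up to \<open>b\<close> is closed under the new
  permutation by \<open>arc_invariant\<close>, and it misses \<open>a\<close>.\<close>

lemma orbit_split:
  assumes p: "permutation p" and b: "b \<in> orbit p a" and ab: "a \<noteq> b"
  shows "b \<notin> orbit (p \<circ> transpose a b) a"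
proof
  let ?N = "card (orbit p a)" and ?q = "p \<circ> transpose a b"
  let ?f = "\<lambda>t. (p ^^ t) a"
  note enum = orbit_enumerate[OF p, of a]
  obtain r where r: "r < ?N" "b = ?f r"
    using b by (subst (asm) enum(2)) auto
  have "0 < r"
    using ab r by (cases r) auto
  have "b \<in> ?f ` {0<..r}"
    using r \<open>0 < r\<close> by auto
  moreover have "?q y \<in> ?f ` {0<..r}" if "y \<in> ?f ` {0<..r}" for y
    using arc_invariant[OF enum(1) \<open>0 < r\<close> r(1) that] r(2) by simp
  ultimately have "orbit ?q b \<subseteq> ?f ` {0<..r}"
    by (rule orbit_subset_invariant)
  moreover have "a \<notin> ?f ` {0<..r}"
    using arc_notin[OF enum(1) r(1), of 0 0] r by auto
  moreover assume "b \<in> orbit ?q a"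
  then have "a \<in> orbit ?q b"
    using p by (metis orbit_swap permutation_comp_transpose permutation_self_in_orbit)
  ultimately show False by blast
qed

text \<open>The exchanged successors lead from \<open>b\<close> into the cycle of \<open>a\<close>
  and from \<open>a\<close> into the cycle of \<open>b\<close>, which joins the two; a cycle
  containing neither point never meets the exchange.\<close>

lemma orbit_merge:
  assumes p: "permutation p" and b: "b \<notin> orbit p a"
  shows "orbit (p \<circ> transpose a b) x =
    (if x \<in> orbit p a \<union> orbit p b then orbit p a \<union> orbit p b else orbit p x)"
proof -
  let ?q = "p \<circ> transpose a b" and ?U = "orbit p a \<union> orbit p b"
  have q: "permutation ?q"
    using p by (rule permutation_comp_transpose)
  note self = permutation_self_in_orbit[OF p] and eq = orbit_eq_iff[OF p]
  \<comment> \<open>Stated for arbitrary points because it is applied in both directions. The new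
    orbit of \<open>b\<close> starts at \<open>p a\<close> and follows the old cycle until it
    reaches \<open>a\<close>.\<close>
  have sub: "orbit p a \<subseteq> orbit (p \<circ> transpose a b) b" if "b \<notin> orbit p a" for a b
  proof
    fix y assume "y \<in> orbit p a"
    then show "y \<in> orbit (p \<circ> transpose a b) b"
    proof induction
      case base
      show ?case by (rule orbit_eqI(1)) simp
    next
      case (step y)
      show ?case
      proof (cases "y = a")
        case True
        show ?thesis by (rule orbit_eqI(1)) (simp add: True)
      next
        case False
        then show ?thesis
          using step that by (intro orbit_eqI(2)[OF _ step.IH]) (auto simp: transpose_def)
      qed
    qed
  qed
  have a: "a \<notin> orbit p b"
    using b eq by blast
  have U1: "orbit p a \<subseteq> orbit ?q b"
    using sub[OF b] .
  have U2: "orbit p b \<subseteq> orbit ?q a"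
    using sub[OF a] by (simp add: transpose_commute)
  have same: "orbit ?q a = orbit ?q b"
    using U2 self orbit_eq_iff[OF q] by blast
  have inv: "?q y \<in> ?U" if "y \<in> ?U" for y
    using that by (auto simp: transpose_def intro: orbit.intros)
  have Ueq: "orbit ?q a = ?U"
    using U1 U2 same orbit_subset_invariant[of a ?U ?q] inv self by blast
  show ?thesis
  proof (cases "x \<in> ?U")
    case True
    then show ?thesis
      using Ueq orbit_eq_iff[OF q] by auto
  next
    case False
    have "orbit ?q x = orbit p x"
    proof (rule orbit_cong[OF self])
      fix s assume "s \<in> orbit p x"
      then have "s \<noteq> a" "s \<noteq> b"
        using False eq self by blast+
      then show "?q s = p s" by simp
    qed
    then show ?thesis using False by simp
  qed
qed

lemma card_orbits_merge:
  assumes p: "permutation p" and D: "finite D" "a \<in> D" "b \<in> D" and b: "b \<notin> orbit p a"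
  shows "Suc (card (orbit (p \<circ> transpose a b) ` D)) = card (orbit p ` D)"
proof -
  let ?q = "p \<circ> transpose a b" and ?U = "orbit p a \<union> orbit p b"
  note self = permutation_self_in_orbit[OF p] and eq = orbit_eq_iff[OF p]
  let ?R = "orbit p ` D - {orbit p a, orbit p b}"
  have img: "orbit ?q ` D = insert ?U ?R"
  proof (intro set_eqI iffI)
    fix K assume "K \<in> orbit ?q ` D"
    then obtain x where "x \<in> D" "K = orbit ?q x" by auto
    then show "K \<in> insert ?U ?R"
      using orbit_merge[OF p b, of x] self by (auto split: if_splits)
  next
    fix K assume "K \<in> insert ?U ?R"
    then consider "K = ?U" | x where "x \<in> D" "K = orbit p x" "K \<noteq> orbit p a" "K \<noteq> orbit p b"
      by auto
    then show "K \<in> orbit ?q ` D"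
    proof cases
      case 1
      then have "K = orbit ?q a"
        using orbit_merge[OF p b, of a] self by simp
      then show ?thesis using D by blast
    next
      case 2
      then have "x \<notin> ?U" using eq by blast
      then have "K = orbit ?q x"
        using orbit_merge[OF p b, of x] 2 by simp
      then show ?thesis using 2 by blast
    qed
  qed
  have "?U \<notin> ?R"
    using self eq by blast
  then have "card (orbit ?q ` D) = Suc (card ?R)"
    using D by (simp add: img)
  moreover have "orbit p a \<noteq> orbit p b"
    using b eq by blast
  then have "card {orbit p a, orbit p b} = 2" by simp
  moreover have "{orbit p a, orbit p b} \<subseteq> orbit p ` D"
    using D by auto
  ultimately show ?thesis
    using D card_Diff_subset[of "{orbit p a, orbit p b}" "orbit p ` D"]
      card_mono[of "orbit p ` D" "{orbit p a, orbit p b}"] by simp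
qed

text \<open>The transposition undoes itself, so a split of \<open>p\<close> is a merge read
  backwards from the composed permutation.\<close>

lemma card_orbits_split:
  assumes p: "permutation p" and D: "finite D" "a \<in> D" "b \<in> D" and b: "b \<in> orbit p a" "a \<noteq> b"
  shows "card (orbit (p \<circ> transpose a b) ` D) = Suc (card (orbit p ` D))"
  using card_orbits_merge[OF permutation_comp_transpose[OF p] D orbit_split[OF p b]]
  by (simp add: comp_assoc)

subsection \<open>Boundary components and partial duals\<close>

text \<open>Off the darts \<open>flip G\<close> is the identity, so the involution law and the
  membership equivalence hold for every \<open>d\<close>.\<close>

lemma ribbon_graphD:
  assumes "ribbon_graph G"
  shows "finite (darts G)" "rot G permutes darts G" "flip G permutes darts G"
    and "flip G (flip G d) = d" "flip G d \<in> darts G \<longleftrightarrow> d \<in> darts G"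
    and "d \<in> darts G \<Longrightarrow> flip G d \<noteq> d"
  using assms permutes_not_in[of "flip G" "darts G" d]
    permutes_in_image[of "flip G" "darts G" d]
  by (auto simp: ribbon_graph_def)

lemma finite_edges: "ribbon_graph G \<Longrightarrow> finite (edges G)"
  by (simp add: edges_def ribbon_graphD)

lemma edge_eq_iff:
  assumes "ribbon_graph G"
  shows "{d, flip G d} = {d', flip G d'} \<longleftrightarrow> d = d' \<or> d = flip G d'"
  using ribbon_graphD(4)[OF assms] by (metis doubleton_eq_iff)

lemma Union_edges_iff:
  assumes G: "ribbon_graph G" and A: "A \<subseteq> edges G"
  shows "d \<in> \<Union>A \<longleftrightarrow> d \<in> darts G \<and> {d, flip G d} \<in> A"
proof
  assume "d \<in> \<Union>A"
  then obtain x where x: "x \<in> darts G" "{x, flip G x} \<in> A" "d = x \<or> d = flip G x"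
    using A unfolding edges_def by blast
  then show "d \<in> darts G \<and> {d, flip G d} \<in> A"
    using ribbon_graphD(4,5)[OF G] by (auto simp: insert_commute)
qed auto

lemma edge_flip: "ribbon_graph G \<Longrightarrow> {flip G d, flip G (flip G d)} = {d, flip G d}"
  by (auto simp: ribbon_graphD)

lemma boundary_walk_eq:
  assumes "ribbon_graph G" "A \<subseteq> edges G"
  shows "boundary_walk G A d =
    (if d \<in> darts G \<and> {d, flip G d} \<in> A then rot G (flip G d) else rot G d)"
  unfolding boundary_walk_def Union_edges_iff[OF assms] ..

lemma boundary_walk_permutes:
  assumes "ribbon_graph G" "A \<subseteq> edges G"
  shows "boundary_walk G A permutes darts G" "permutation (boundary_walk G A)"
  using ribbon_graph_partial_dual[OF assms] ribbon_graphD(1)[OF assms(1)]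
  by (auto simp: ribbon_graph_def partial_dual_def permutation_permutes)

lemma boundary_walk_empty: "boundary_walk G {} = rot G"
  by (rule ext) (simp add: boundary_walk_def)

text \<open>The walk for \<open>A\<close> is the rotation preceded by \<open>flip G\<close> on the
  ends of \<open>A\<close>. Doing this for \<open>A\<close> and then for \<open>B\<close> flips
  twice on common edges, which cancels.\<close>

lemma boundary_walk_partial_dual:
  assumes G: "ribbon_graph G" and A: "A \<subseteq> edges G" and B: "B \<subseteq> edges G"
  shows "boundary_walk (partial_dual G A) B = boundary_walk G (sym_diff A B)"
proof
  fix d
  have "sym_diff A B \<subseteq> edges G" using A B by blast
  note iff = boundary_walk_eq[OF G A] boundary_walk_eq[OF G this]
    boundary_walk_eq[OF ribbon_graph_partial_dual[OF G A], unfolded edges_partial_dual, OF B]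
  show "boundary_walk (partial_dual G A) B d = boundary_walk G (sym_diff A B) d"
    unfolding iff by (auto simp: partial_dual_def iff(1) ribbon_graphD[OF G] insert_commute)
qed

lemma partial_dual_partial_dual:
  assumes "ribbon_graph G" "A \<subseteq> edges G" "B \<subseteq> edges G"
  shows "partial_dual (partial_dual G A) B = partial_dual G (sym_diff A B)"
  using boundary_walk_partial_dual[OF assms] by (simp add: partial_dual_def)

lemma partial_dual_empty: "partial_dual G {} = G"
  by (simp add: partial_dual_def boundary_walk_empty)

text \<open>Passing into or out of \<open>A\<close> interchanges the successors of the two ends of
  the edge and no others. Counting boundary components thus becomes counting cycles under a
  transposition.\<close>

lemma boundary_walk_toggle:
  assumes G: "ribbon_graph G" and A: "A \<subseteq> edges G" and a: "a \<in> darts G"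
  shows "boundary_walk G (sym_diff A {{a, flip G a}}) = boundary_walk G A \<circ> transpose a (flip G a)"
proof
  fix d
  have e: "{{a, flip G a}} \<subseteq> edges G" using a by (auto simp: edges_def)
  then have "sym_diff A {{a, flip G a}} \<subseteq> edges G" using A by blast
  note iff = boundary_walk_eq[OF G A] boundary_walk_eq[OF G this]
  consider "d = a" | "d = flip G a" | "d \<noteq> a" "d \<noteq> flip G a" by blast
  then show "boundary_walk G (sym_diff A {{a, flip G a}}) d =
      (boundary_walk G A \<circ> transpose a (flip G a)) d"
  proof cases
    case 3
    then have "{d, flip G d} \<noteq> {a, flip G a}" using edge_eq_iff[OF G] by blast
    then show ?thesis
      using 3 by (simp add: iff)
  qed (use a in \<open>simp_all add: iff ribbon_graphD[OF G] insert_commute\<close>)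
qed

lemma num_boundary_toggle:
  fixes a :: 'd
  assumes G: "ribbon_graph G" and A: "A \<subseteq> edges G" and a: "a \<in> darts G"
  defines "B \<equiv> sym_diff A {{a, flip G a}}"
  shows "if flip G a \<in> orbit (boundary_walk G A) a
    then num_boundary G B = Suc (num_boundary G A) else Suc (num_boundary G B) = num_boundary G A"
proof -
  note p = boundary_walk_permutes(2)[OF G A]
  have fa: "flip G a \<in> darts G" "flip G a \<noteq> a"
    using a ribbon_graphD(5,6)[OF G] by auto
  show ?thesis
    unfolding num_boundary_def B_def boundary_walk_toggle[OF G A a]
    using card_orbits_merge[OF p ribbon_graphD(1)[OF G] a fa(1)]
      card_orbits_split[OF p ribbon_graphD(1)[OF G] a fa(1)] fa(2)
    by auto
qed

lemma sym_diff_insert: "e \<notin> A \<Longrightarrow> sym_diff A {e} = insert e A"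
  and sym_diff_remove: "e \<in> A \<Longrightarrow> sym_diff A {e} = A - {e}"
  by auto

text \<open>Each inserted edge changes the number of boundary components by exactly one. The parity
  makes the division in \<open>genus\<close> exact and later forces an odd number of edges.\<close>

lemma num_boundary_parity:
  assumes G: "ribbon_graph G" and A: "A \<subseteq> edges G"
  shows "even (num_boundary G A + num_boundary G {} + card A)"
  using finite_subset[OF A finite_edges[OF G]] A
proof (induction rule: finite_induct)
  case (insert e A)
  then obtain a where a: "a \<in> darts G" "e = {a, flip G a}"
    by (auto simp: edges_def)
  have "sym_diff A {e} = insert e A"
    using insert(2) by (rule sym_diff_insert)
  then have "num_boundary G (insert e A) = Suc (num_boundary G A) \<or>
      Suc (num_boundary G (insert e A)) = num_boundary G A"
    using num_boundary_toggle[OF G _ a(1), of A] insert.prems unfolding a(2)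
    by (auto split: if_splits)
  moreover have "even (num_boundary G A + num_boundary G {} + card A)"
    using insert by simp
  moreover have "card (insert e A) = Suc (card A)"
    using insert by simp
  ultimately show ?case by presburger
qed simp

lemma num_components_partial_dual:
  assumes G: "ribbon_graph G" and A: "A \<subseteq> edges G"
  shows "num_components (partial_dual G A) = num_components G"
proof -
  define R :: "'a rgraph \<Rightarrow> ('a \<times> 'a) set" where
    "R G = {(x, rot G x) | x. x \<in> darts G} \<union> {(x, flip G x) | x. x \<in> darts G}" for G
  \<comment> \<open>Stated for every ribbon graph so that it also applies to the dual: dualising
    again by \<open>A\<close> returns the original, which yields the reverse inclusion of the
    closures.\<close>
  have sub: "R (partial_dual G A) \<subseteq> (R G)\<^sup>*"
    if G: "ribbon_graph G" and A: "A \<subseteq> edges G" for G :: "'a rgraph" and A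
  proof -
    have "(x, rot G (flip G x)) \<in> (R G)\<^sup>*" if x: "x \<in> darts G" for x
    proof -
      have "(x, flip G x) \<in> R G" "(flip G x, rot G (flip G x)) \<in> R G"
        using x ribbon_graphD(5)[OF G] by (auto simp: R_def)
      then show ?thesis by (meson converse_rtrancl_into_rtrancl r_into_rtrancl)
    qed
    moreover have "(x, rot G x) \<in> (R G)\<^sup>*" "(x, flip G x) \<in> (R G)\<^sup>*" if "x \<in> darts G" for x
      using that by (auto simp: R_def)
    ultimately have "(x, boundary_walk G A x) \<in> (R G)\<^sup>*" "(x, flip G x) \<in> (R G)\<^sup>*"
      if "x \<in> darts G" for x
      using that by (simp_all add: boundary_walk_def)
    then show ?thesis
      unfolding R_def[of "partial_dual G A"] by (auto simp: partial_dual_def)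
  qed
  let ?H = "partial_dual G A"
  have "partial_dual ?H A = G"
    using partial_dual_partial_dual[OF G A A] by (simp add: partial_dual_empty)
  then have "R G \<subseteq> (R ?H)\<^sup>*"
    using sub[OF ribbon_graph_partial_dual[OF G A], of A] A by (simp add: edges_partial_dual)
  then have "(R ?H)\<^sup>* = (R G)\<^sup>*"
    using sub[OF G A] by (metis rtrancl_subset_rtrancl subset_antisym)
  then show ?thesis
    unfolding num_components_def R_def[symmetric] by (simp add: partial_dual_def)
qed

text \<open>The vertex-discs of the dual are the boundary components for \<open>A\<close>. Its
  face-discs are those for the complement, the symmetric difference of \<open>A\<close> with all
  edges. The division in \<open>genus\<close> is exact by parity.\<close>

lemma genus_partial_dual:
  assumes G: "ribbon_graph G" and A: "A \<subseteq> edges G"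
  shows "2 * genus (partial_dual G A) = 2 * int (num_components G) + int (card (edges G))
    - int (num_boundary G A) - int (num_boundary G (edges G - A))"
proof -
  have "num_vertices (partial_dual G A) = num_boundary G A"
    by (simp add: num_vertices_def num_boundary_def partial_dual_def)
  moreover have "sym_diff A (edges G) = edges G - A"
    using A by blast
  then have "num_boundary (partial_dual G A) (edges G) = num_boundary G (edges G - A)"
    using boundary_walk_partial_dual[OF G A subset_refl]
    by (simp add: num_boundary_def) (simp add: partial_dual_def)
  ultimately have chi: "euler_char (partial_dual G A) =
      int (num_boundary G A) - int (card (edges G)) + int (num_boundary G (edges G - A))"
    by (simp add: euler_char_def edges_partial_dual)
  have "card (edges G) = card A + card (edges G - A)"
    using A finite_edges[OF G] by (metis card_Diff_subset card_mono finite_subset le_add_diff_inverse)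
  then have "even (euler_char (partial_dual G A))"
    using num_boundary_parity[OF G A] num_boundary_parity[OF G, of "edges G - A"]
    unfolding chi by (simp; presburger)
  then show ?thesis
    unfolding genus_def num_components_partial_dual[OF G A] by (simp add: chi)
qed

subsection \<open>Splitting off a ribbon-join summand\<close>

lemma ribbon_iso_refl: "ribbon_iso G G"
  unfolding ribbon_iso_def
  by (intro conjI refl exI[of _ id] exI[of _ "{}"]) (auto simp: bij_betw_def)

text \<open>Exchanging the successors of \<open>d1\<close> and \<open>d2\<close> leaves a rotation
  that preserves \<open>I\<close> and its complement. The two restrictions are the summands, and the
  same transposition applied again is the gluing of \<open>at_arcs\<close>.\<close>

lemma not_join_prime_if_split:
  fixes G :: "'d rgraph"
  assumes G: "ribbon_graph G" and iso: "isolated G = 0"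
    and I: "I \<subseteq> darts G" "\<And>d. d \<in> I \<Longrightarrow> flip G d \<in> I"
    and d: "d1 \<in> I" "d2 \<in> darts G" "d2 \<notin> I"
    and inv: "\<And>d. d \<in> I \<Longrightarrow> rot G (transpose d1 d2 d) \<in> I"
  shows "\<not> join_prime G"
proof -
  let ?D = "darts G" and ?J = "darts G - I"
  define q where "q = rot G \<circ> transpose d1 d2"
  have q: "q permutes ?D"
    unfolding q_def using d I ribbon_graphD(2)[OF G]
    by (intro permutes_compose permutes_swap_id) auto
  note fin = ribbon_graphD(1)[OF G] and flp = ribbon_graphD(3)[OF G]
  have restr: "perm_restrict p I permutes I" "perm_restrict p ?J permutes ?J"
    if p: "p permutes ?D" and "\<And>d. d \<in> I \<Longrightarrow> p d \<in> I" for p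
  proof -
    have "inj p" using p by (rule permutes_inj)
    \<comment> \<open>An injective self-map of the finite set \<open>I\<close> is onto, so the
      complement is preserved as well.\<close>
    have "p ` I \<subseteq> I" using that by auto
    then have I_eq: "p ` I = I"
      using endo_inj_surj[of I p] \<open>inj p\<close> fin I(1) by (meson finite_subset inj_on_subset subset_UNIV)
    then have "p ` ?J = ?J"
      using \<open>inj p\<close> permutes_image[OF p] by (metis image_set_diff)
    have "perm_restrict p S permutes S" if "p ` S = S" for S
    proof (rule bij_imp_permutes)
      have "bij_betw p S S"
        using that \<open>inj p\<close> by (auto simp: bij_betw_def intro: inj_on_subset)
      then show "bij_betw (perm_restrict p S) S S"
        by (subst bij_betw_cong[of S _ p]) (simp_all add: perm_restrict_simps)
    qed (simp add: perm_restrict_simps)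
    with I_eq \<open>p ` ?J = ?J\<close>
    show "perm_restrict p I permutes I" "perm_restrict p ?J permutes ?J"
      by blast+
  qed
  have qI: "q d \<in> I" if "d \<in> I" for d
    using inv[OF that] by (simp add: q_def)
  have rq: "perm_restrict q I permutes I" "perm_restrict q ?J permutes ?J"
    using restr[OF q] qI by blast+
  have rf: "perm_restrict (flip G) I permutes I" "perm_restrict (flip G) ?J permutes ?J"
    using restr[OF flp] I(2) by blast+
  define part :: "'d set \<Rightarrow> 'd rgraph" where "part S =
    \<lparr>darts = S, rot = perm_restrict q S, flip = perm_restrict (flip G) S, isolated = 0\<rparr>" for S
  have union: "perm_restrict p I \<circ> perm_restrict p ?J = p"
    if "p permutes ?D" "perm_restrict p I permutes I" "perm_restrict p ?J permutes ?J" for p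
  proof -
    have "perm_restrict p I \<circ> perm_restrict p ?J = perm_restrict p (I \<union> ?J)"
      using that by (intro perm_restrict_union) auto
    also have "I \<union> ?J = ?D" using I by auto
    finally show ?thesis using perm_restrict_id[OF that(1)] by metis
  qed
  have part: "ribbon_graph (part S)"
    if S: "S \<subseteq> ?D" and "perm_restrict q S permutes S" and f: "perm_restrict (flip G) S permutes S"
    for S
  proof -
    have "flip G x \<in> S" if "x \<in> S" for x
      using that permutes_in_image[OF f, of x] by (simp add: perm_restrict_simps)
    then have "\<forall>x\<in>S. perm_restrict (flip G) S x \<noteq> x \<and>
        perm_restrict (flip G) S (perm_restrict (flip G) S x) = x"
      using S ribbon_graphD(4,6)[OF G] by (simp add: perm_restrict_simps subset_iff)
    then show ?thesis
      using that finite_subset[OF S fin] by (simp add: ribbon_graph_def part_def)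
  qed
  have "ribbon_graph (part I)" "ribbon_graph (part ?J)"
    using part[OF I(1) rq(1) rf(1)] part[OF Diff_subset rq(2) rf(2)] .
  moreover have "edges (part I) \<noteq> {}" "edges (part ?J) \<noteq> {}"
    using d by (auto simp: edges_def part_def)
  moreover have "ribbon_join (part I) (part ?J)
      \<lparr>darts = darts (part I) \<union> darts (part ?J),
       rot = rot (part I) \<circ> rot (part ?J) \<circ> transpose d1 d2,
       flip = flip (part I) \<circ> flip (part ?J),
       isolated = isolated (part I) + isolated (part ?J)\<rparr>"
    using d by (intro at_arcs) (auto simp: part_def)
  moreover have "rot (part I) \<circ> rot (part ?J) \<circ> transpose d1 d2 = rot G"
    using union[OF q rq] by (simp add: part_def q_def comp_assoc)
  moreover have "flip (part I) \<circ> flip (part ?J) = flip G"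
    using union[OF flp rf] by (simp add: part_def)
  moreover have "darts (part I) \<union> darts (part ?J) = ?D"
    using I by (auto simp: part_def)
  moreover have "isolated (part I) + isolated (part ?J) = isolated G"
    by (simp add: part_def iso)
  moreover have "\<lparr>darts = ?D, rot = rot G, flip = flip G, isolated = isolated G\<rparr> = G"
    by (cases G) simp
  ultimately have "ribbon_join (part I) (part ?J) G"
    by simp
  then show ?thesis
    using \<open>ribbon_graph (part I)\<close> \<open>ribbon_graph (part ?J)\<close>
      \<open>edges (part I) \<noteq> {}\<close> \<open>edges (part ?J) \<noteq> {}\<close> ribbon_iso_refl[of G]
    unfolding join_prime_def by blast
qed

text \<open>The rotations of \<open>G\<close> and of its dual differ by \<open>flip G\<close> on the
  ends of \<open>A\<close>, an involution preserving every set closed under \<open>flip G\<close>.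
  Hence the same \<open>I\<close> splits \<open>G\<close>, with \<open>d1\<close> and
  \<open>d2\<close> replaced by their images under it.\<close>

lemma not_join_prime_if_partial_dual_split:
  assumes G: "ribbon_graph G" and A: "A \<subseteq> edges G" and iso: "isolated G = 0"
    and I: "I \<subseteq> darts G" "\<And>d. d \<in> I \<Longrightarrow> flip G d \<in> I"
    and d: "d1 \<in> I" "d2 \<in> darts G" "d2 \<notin> I"
    and inv: "\<And>d. d \<in> I \<Longrightarrow> rot (partial_dual G A) (transpose d1 d2 d) \<in> I"
  shows "\<not> join_prime G"
proof -
  define p where "p d = (if d \<in> \<Union>A then flip G d else d)" for d
  note iff = Union_edges_iff[OF G A]
  have pp: "p (p d) = d" for d
    unfolding p_def iff by (simp add: ribbon_graphD[OF G] insert_commute)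
  have pI: "p d \<in> I" if "d \<in> I" for d
    using I(2) that by (simp add: p_def)
  have rot: "rot G d = rot (partial_dual G A) (p d)" for d
    unfolding p_def iff
    by (auto simp: partial_dual_def boundary_walk_eq[OF G A] ribbon_graphD[OF G] insert_commute)
  have conj: "p (transpose (p d1) (p d2) d) = transpose d1 d2 (p d)" for d
  proof -
    have "p d = d1 \<longleftrightarrow> d = p d1" "p d = d2 \<longleftrightarrow> d = p d2"
      using pp by metis+
    then show ?thesis by (simp add: transpose_def pp)
  qed
  show ?thesis
  proof (rule not_join_prime_if_split[OF G iso I])
    show "p d1 \<in> I" "p d2 \<in> darts G"
      using pI d by (auto simp: p_def ribbon_graphD[OF G])
    show "p d2 \<notin> I"
      using pI pp d by metis
    show "rot G (transpose (p d1) (p d2) d) \<in> I" if "d \<in> I" for d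
      unfolding rot conj using that by (intro inv pI)
  qed
qed

section \<open>Existence of a one-vertex partial dual\<close>

text \<open>Minimise the number of boundary components. No edge then has its ends on two different
  ones, since toggling it would merge them; so each orbit of the walk is closed under
  \<open>flip G\<close> and \<open>rot G\<close>, and connectedness leaves only one.\<close>

lemma ex_num_boundary_eq_1:
  fixes G :: "'d rgraph"
  assumes G: "ribbon_graph G" and conn: "connected_rg G" and ne: "darts G \<noteq> {}"
  shows "isolated G = 0" "\<exists>A \<subseteq> edges G. num_boundary G A = 1"
proof -
  define R where
    "R = {(x, rot G x) | x. x \<in> darts G} \<union> {(x, flip G x) | x. x \<in> darts G}"
  define comp where "comp d = {d'. (d, d') \<in> R\<^sup>*}" for d
  have fin: "finite (darts G)" using G by (rule ribbon_graphD)
  have one: "card (comp ` darts G) + isolated G = 1"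
    using conn unfolding connected_rg_def num_components_def R_def comp_def by simp
  moreover have "card (comp ` darts G) > 0"
    using ne fin by (simp add: card_gt_0_iff)
  ultimately show iso: "isolated G = 0" by simp
  with one obtain K where K: "comp ` darts G = {K}"
    by (auto simp: card_1_singleton_iff)
  obtain A where A: "A \<subseteq> edges G"
    and min: "\<And>B. B \<subseteq> edges G \<Longrightarrow> num_boundary G A \<le> num_boundary G B"
    using ex_has_least_nat[of "\<lambda>A. A \<subseteq> edges G" "{}" "num_boundary G"] by auto
  let ?p = "boundary_walk G A"
  note p = boundary_walk_permutes[OF G A]
  have flip: "flip G a \<in> orbit ?p a" if a: "a \<in> darts G" for a
  proof (rule ccontr)
    assume "flip G a \<notin> orbit ?p a"
    then have "num_boundary G (sym_diff A {{a, flip G a}}) < num_boundary G A"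
      using num_boundary_toggle[OF G A a] by simp
    moreover have "sym_diff A {{a, flip G a}} \<subseteq> edges G"
      using A a by (auto simp: edges_def)
    ultimately show False
      using min by (meson not_le)
  qed
  have orb: "orbit ?p a = darts G" if a: "a \<in> darts G" for a
  proof
    show "orbit ?p a \<subseteq> darts G"
      using p(1) a by (rule permutes_orbit_subset)
    show "darts G \<subseteq> orbit ?p a"
    proof
      fix b assume "b \<in> darts G"
      then have "b \<in> K" "K = comp a"
        using K a by (auto simp: comp_def)
      then have "(a, b) \<in> R\<^sup>*" by (simp add: comp_def)
      then show "b \<in> orbit ?p a"
      proof induction
        case base
        show ?case by (rule permutation_self_in_orbit[OF p(2)])
      next
        case (step x y)
        then have x: "x \<in> darts G" by (auto simp: R_def)
        have "flip G x \<in> orbit ?p a"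
          using flip[OF x] step.IH by (rule orbit_trans)
        moreover from this have "?p x \<in> orbit ?p a" "?p (flip G x) \<in> orbit ?p a"
          using step.IH by (simp_all only: orbit.step)
        \<comment> \<open>The walk moves to \<open>rot G x\<close> from \<open>x\<close> or from
          \<open>flip G x\<close>, according as the edge of \<open>x\<close> lies outside or inside
          \<open>A\<close>.\<close>
        moreover have "rot G x = ?p x \<or> rot G x = ?p (flip G x)"
          by (simp add: boundary_walk_eq[OF G A] ribbon_graphD[OF G] insert_commute)
        ultimately have "rot G x \<in> orbit ?p a" "flip G x \<in> orbit ?p a"
          by metis+
        then show ?case
          using step.hyps(2) by (auto simp: R_def)
      qed
    qed
  qed
  then have "orbit ?p ` darts G = {darts G}" using ne by auto
  then have "num_boundary G A = 1" by (simp add: num_boundary_def iso)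
  then show "\<exists>A \<subseteq> edges G. num_boundary G A = 1" using A by blast
qed

subsection \<open>Bouquets whose partial duals all have the same genus\<close>

text \<open>By \<open>genus_partial_dual\<close>, balance expresses that all partial duals have the
  same genus. Boundary components of the empty edge set are the vertices.\<close>

locale balanced_bouquet =
  fixes H :: "'d rgraph" and c :: nat
  assumes H: "ribbon_graph H" and iso: "isolated H = 0" and one_vertex: "num_boundary H {} = 1"
    and balanced: "A \<subseteq> edges H \<Longrightarrow> num_boundary H A + num_boundary H (edges H - A) = c"
begin

abbreviation "D \<equiv> darts H"

abbreviation edge :: "'d \<Rightarrow> 'd set" where "edge a \<equiv> {a, flip H a}"

abbreviation "face \<equiv> orbit (boundary_walk H (edges H))"

text \<open>Orbits of the walk with all edges are the face-discs, so the image of an edge is the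
  unordered pair of faces beside it. In this form the relation is visibly transitive, unlike
  interlacement.\<close>

definition parallel :: "'d \<Rightarrow> 'd \<Rightarrow> bool" where
  "parallel a b \<longleftrightarrow> face ` edge a = face ` edge b"

lemma edge_in: "a \<in> D \<Longrightarrow> edge a \<in> edges H"
  by (auto simp: edges_def)

lemma flip_in: "flip H a \<in> D \<longleftrightarrow> a \<in> D"
  using H by (rule ribbon_graphD)

lemma finite_darts: "finite D"
  using H by (rule ribbon_graphD)

lemma parallel_refl: "parallel a a"
  and parallel_sym: "parallel a b \<Longrightarrow> parallel b a"
  and parallel_trans: "parallel a b \<Longrightarrow> parallel b d \<Longrightarrow> parallel a d"
  and parallel_flip: "parallel a (flip H b) \<longleftrightarrow> parallel a b"
  using edge_flip[OF H, of b] by (auto simp only: parallel_def)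

lemma permutation_rot: "permutation (rot H)"
  using boundary_walk_permutes(2)[OF H, of "{}"] by (simp add: boundary_walk_empty)

lemma orbit_rot:
  assumes a: "a \<in> D"
  shows "orbit (rot H) a = D"
proof
  show "orbit (rot H) a \<subseteq> D"
    using ribbon_graphD(2)[OF H] a by (rule permutes_orbit_subset)
  show "D \<subseteq> orbit (rot H) a"
  proof
    fix b assume "b \<in> D"
    moreover obtain K where "orbit (rot H) ` D = {K}"
      using one_vertex by (auto simp: num_boundary_def iso boundary_walk_empty card_1_singleton_iff)
    ultimately have "orbit (rot H) a = orbit (rot H) b"
      using a by (metis imageI singletonD)
    then show "b \<in> orbit (rot H) a"
      using orbit_eq_iff[OF permutation_rot] by blast
  qed
qed

lemma num_boundary_single:
  assumes a: "a \<in> D"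
  shows "num_boundary H {edge a} = 2"
  using num_boundary_toggle[OF H empty_subsetI a] orbit_rot[OF a] a one_vertex
  by (simp add: boundary_walk_empty flip_in)

lemma boundary_walk_single:
  "a \<in> D \<Longrightarrow> boundary_walk H {edge a} = rot H \<circ> transpose a (flip H a)"
  using boundary_walk_toggle[OF H empty_subsetI, of a] by (simp add: boundary_walk_empty)

text \<open>Compare balance for the empty set with balance for a single edge, whose ribbon splits
  the vertex circle in two.\<close>

lemma num_boundary_Diff_single:
  assumes a: "a \<in> D"
  shows "Suc (num_boundary H (edges H - {edge a})) = num_boundary H (edges H)"
  using balanced[of "{}"] balanced[of "{edge a}"] edge_in[OF a] num_boundary_single[OF a] one_vertex
  by simp

text \<open>Deleting an edge loses a boundary component, so it must merge two different
  faces.\<close>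

lemma face_flip:
  assumes a: "a \<in> D"
  shows "flip H a \<notin> face a"
  using num_boundary_toggle[OF H subset_refl a] num_boundary_Diff_single[OF a]
  unfolding sym_diff_remove[OF edge_in[OF a]] by (simp split: if_splits)

text \<open>
  By balance, adding the edge of \<open>b\<close> to that of \<open>a\<close> raises the number of boundary components
  iff deleting both from \<open>edges H\<close> lowers it. So \<open>a\<close> and \<open>b\<close> are interlaced iff merging the two
  faces at \<open>a\<close> also merges those at \<open>b\<close>.
\<close>

lemma interlaced_iff_parallel:
  assumes a: "a \<in> D" and b: "b \<in> D" and ne: "edge a \<noteq> edge b"
  shows "flip H b \<notin> orbit (boundary_walk H {edge a}) b \<longleftrightarrow> parallel a b"
    and "num_boundary H {edge a, edge b} = (if parallel a b then 1 else 3)"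
proof -
  let ?E = "edges H" and ?A = "edges H - {edge a}"
  have sub: "{edge a} \<subseteq> ?E" "?A \<subseteq> ?E" "{edge a, edge b} \<subseteq> ?E"
    using a b by (auto simp: edges_def)
  have s1: "sym_diff {edge a} {edge b} = {edge a, edge b}"
    using ne by auto
  have s2: "sym_diff ?A {edge b} = ?E - {edge a, edge b}"
    using edge_in[OF b] ne by auto
  note t1 = num_boundary_toggle[OF H sub(1) b, unfolded s1, unfolded num_boundary_single[OF a]]
  note t2 = num_boundary_toggle[OF H sub(2) b, unfolded s2]
  have iff: "flip H b \<in> orbit (boundary_walk H {edge a}) b \<longleftrightarrow>
      flip H b \<notin> orbit (boundary_walk H ?A) b"
    using t1 t2 balanced[OF sub(1)] balanced[OF sub(3)] num_boundary_single[OF a]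
    by (auto split: if_splits)
  note p = boundary_walk_permutes(2)[OF H subset_refl]
  note eq = orbit_eq_iff[OF p] and self = permutation_self_in_orbit[OF p]
  have "boundary_walk H ?A = boundary_walk H ?E \<circ> transpose a (flip H a)"
    using boundary_walk_toggle[OF H subset_refl a] unfolding sym_diff_remove[OF edge_in[OF a]] .
  then have orb: "orbit (boundary_walk H ?A) b = (if b \<in> face a \<union> face (flip H a)
      then face a \<union> face (flip H a) else face b)"
    using orbit_merge[OF p face_flip[OF a]] by simp
  \<comment> \<open>The faces beside \<open>b\<close> are distinct, so deleting the edge of
    \<open>a\<close> joins them only if both are among the two merged faces.\<close>
  have "flip H b \<in> orbit (boundary_walk H ?A) b \<longleftrightarrow>
      b \<in> face a \<union> face (flip H a) \<and> flip H b \<in> face a \<union> face (flip H a)"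
    using orb face_flip[OF b] by auto
  also have "\<dots> \<longleftrightarrow> parallel a b"
    using face_flip[OF a] face_flip[OF b] unfolding eq[symmetric] Un_iff parallel_def
    by (auto simp: doubleton_eq_iff)
  finally show *: "flip H b \<notin> orbit (boundary_walk H {edge a}) b \<longleftrightarrow> parallel a b"
    using iff by blast
  show "num_boundary H {edge a, edge b} = (if parallel a b then 1 else 3)"
    using t1 * by (auto split: if_splits)
qed

text \<open>
  Ends of two interlaced edges lie on the same side of every chord \<open>y\<close> that neither of them
  crosses: otherwise the three chords would bound four regions, but two interlaced chords bound
  one region and a third one adds at most one.
\<close>

lemma same_side:
  assumes D: "y \<in> D" "a \<in> D" "b \<in> D"
    and par: "parallel a b" "\<not> parallel y a" "\<not> parallel y b"
  shows "orbit (boundary_walk H {edge y}) a = orbit (boundary_walk H {edge y}) b"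
proof -
  let ?p = "boundary_walk H {edge y}" and ?q = "boundary_walk H {edge y, edge a}"
  have sub: "{edge y} \<subseteq> edges H" "{edge y, edge a} \<subseteq> edges H" "{edge a, edge b} \<subseteq> edges H"
    using D by (auto simp: edges_def)
  note p = boundary_walk_permutes(2)[OF H sub(1)]
  have ne: "edge y \<noteq> edge a" "edge y \<noteq> edge b"
    using par(2,3) parallel_def by fastforce+
  have a: "flip H a \<in> orbit ?p a" and b: "flip H b \<in> orbit ?p b"
    using interlaced_iff_parallel(1)[OF D(1,2) ne(1)] interlaced_iff_parallel(1)[OF D(1,3) ne(2)]
      par by auto
  show ?thesis
  proof (cases "edge a = edge b")
    case True
    then have "b = a \<or> b = flip H a"
      using edge_eq_iff[OF H, of b a] by auto
    then show ?thesis
      using a orbit_eq_iff[OF p] by auto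
  next
    case False
    show ?thesis
    proof (rule ccontr)
      assume diff: "orbit ?p a \<noteq> orbit ?p b"
      have "sym_diff {edge y} {edge a} = {edge y, edge a}"
        using ne by auto
      then have q: "?q = ?p \<circ> transpose a (flip H a)"
        using boundary_walk_toggle[OF H sub(1) D(2)] by simp
      \<comment> \<open>The exchange acts inside the orbit of \<open>a\<close> only. So the ends of
        \<open>b\<close> still share an orbit, and the third chord adds a region just as the first
        two did.\<close>
      have "orbit ?q b = orbit ?p b"
      proof (rule orbit_cong[OF permutation_self_in_orbit[OF p]])
        fix s assume "s \<in> orbit ?p b"
        then have "orbit ?p s = orbit ?p b" using orbit_eq_iff[OF p] by blast
        moreover have "orbit ?p (flip H a) = orbit ?p a" using a orbit_eq_iff[OF p] by blast
        ultimately have "s \<noteq> a" "s \<noteq> flip H a" using diff by auto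
        then show "?q s = ?p s" by (simp add: q)
      qed
      moreover have "edge b \<notin> {edge y, edge a}"
        using ne False by blast
      then have "sym_diff {edge y, edge a} {edge b} = {edge b, edge y, edge a}"
        by (rule sym_diff_insert)
      ultimately have "num_boundary H {edge b, edge y, edge a} = 4"
        using num_boundary_toggle[OF H sub(2) D(3)] b interlaced_iff_parallel(2)[OF D(1,2) ne(1)]
          par by simp
      \<comment> \<open>Now insert the same three edges in another order, ending with
        \<open>y\<close>.\<close>
      moreover have "edge y \<notin> {edge a, edge b}"
        using ne by blast
      then have "sym_diff {edge a, edge b} {edge y} = {edge y, edge a, edge b}"
        by (rule sym_diff_insert)
      then have "num_boundary H {edge y, edge a, edge b} \<le> 2"
        using num_boundary_toggle[OF H sub(3) D(1)] interlaced_iff_parallel(2)[OF D(2,3) False] par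
        by (auto split: if_splits)
      moreover have "{edge b, edge y, edge a} = {edge y, edge a, edge b}" by blast
      ultimately show False by simp
    qed
  qed
qed

section \<open>Several classes of edges: an arc that splits off\<close>

text \<open>The arc is the gap around \<open>y0\<close> between cyclically consecutive ends of the
  class of \<open>x0\<close>. An edge leaving the gap would separate the two ends bounding it,
  against \<open>same_side\<close>.\<close>

lemma ex_invariant_arc:
  assumes x0: "x0 \<in> D" and y0: "y0 \<in> D" "\<not> parallel x0 y0"
  shows "\<exists>I d1 d2. I \<subseteq> D \<and> (\<forall>d\<in>I. flip H d \<in> I) \<and> d1 \<in> I \<and> d2 \<in> D \<and> d2 \<notin> I \<and>
    (\<forall>d\<in>I. rot H (transpose d1 d2 d) \<in> I)"
proof -
  define f where "f t = (rot H ^^ t) x0" for t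
  define X where "X = {x \<in> D. parallel x0 x}"
  let ?N = "card D"
  note enum = orbit_enumerate[OF permutation_rot, of x0, unfolded orbit_rot[OF x0], folded f_def]
  have f0: "f 0 = x0" by (simp add: f_def)
  have X0: "f 0 \<in> X" using x0 parallel_refl by (simp add: f0 X_def)
  have fN: "f ?N = f 0" using enum(3) f0 by simp
  have fD: "f t \<in> D" for t
    unfolding f_def using ribbon_graphD(2)[OF H] x0
    by (induction t) (auto simp: permutes_in_image)
  obtain q where q: "q < ?N" "y0 = f q"
    using y0(1) enum(2) by auto
  have "f q \<notin> X" using y0(2) q by (simp add: X_def)
  \<comment> \<open>\<open>m\<close> and, below, \<open>p\<close> are the nearest positions of the
    class before and after \<open>y0\<close>. Position \<open>p\<close> may be
    \<open>card D\<close>, where the circle is back at \<open>x0\<close>.\<close>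
  define m where "m = Max {t. t < q \<and> f t \<in> X}"
  have fin: "finite {t. t < q \<and> f t \<in> X}" by simp
  have "0 \<in> {t. t < q \<and> f t \<in> X}"
    using X0 \<open>f q \<notin> X\<close> by (cases q) auto
  then have m: "m < q" "f m \<in> X"
    using Max_in[OF fin] unfolding m_def by blast+
  have m_max: "f t \<notin> X" if "m < t" "t < q" for t
  proof
    assume "f t \<in> X"
    then have "t \<le> m"
      unfolding m_def using fin that by (intro Max_ge) auto
    then show False using that by simp
  qed
  define p where "p = (LEAST t. q < t \<and> f t \<in> X)"
  have "q < ?N \<and> f ?N \<in> X" using q X0 fN by simp
  then have p: "q < p" "f p \<in> X" "p \<le> ?N"
    unfolding p_def using LeastI[of "\<lambda>t. q < t \<and> f t \<in> X" ?N]
    by (blast intro: Least_le)+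
  have p_min: "f t \<notin> X" if "q < t" "t < p" for t
    using not_less_Least[of t "\<lambda>t. q < t \<and> f t \<in> X"] that unfolding p_def by auto
  define r where "r = p - 1"
  have r: "m < r" "r < ?N" "p = Suc r"
    using m p by (auto simp: r_def)
  define J where "J = f ` {m<..r}"
  have JX: "y \<notin> X" if y: "y \<in> J" for y
  proof -
    obtain t where t: "t \<in> {m<..r}" "y = f t" using y by (auto simp: J_def)
    then consider "m < t" "t < q" | "t = q" | "q < t" "t < p"
      using r by force
    then show ?thesis
      using m_max p_min \<open>f q \<notin> X\<close> t by cases auto
  qed
  have arc: "rot H (transpose (f l) (f u) z) \<in> f ` {l<..u}"
    if "l < u" "u < ?N" "z \<in> f ` {l<..u}" for l u z
    using arc_invariant[OF enum(1)[unfolded f_def] that(1,2), of z] that(3) by (simp add: f_def)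
  have notin: "f t \<notin> f ` {l<..u}" if "u < ?N" "t < ?N" "t \<notin> {l<..u}" for t l u
    using arc_notin[OF enum(1)[unfolded f_def] that] by (simp add: f_def)
  have closed: "flip H y \<in> J" if y: "y \<in> J" for y
  proof (rule ccontr)
    assume nJ: "flip H y \<notin> J"
    obtain \<alpha> where \<alpha>: "m < \<alpha>" "\<alpha> \<le> r" "y = f \<alpha>"
      using y by (auto simp: J_def)
    have yD: "y \<in> D" using \<alpha> fD by simp
    then obtain \<beta> where \<beta>: "\<beta> < ?N" "flip H y = f \<beta>"
      using enum(2) flip_in by (metis imageE lessThan_iff)
    \<comment> \<open>The other end of \<open>y\<close> is not in the class either, so it lies
      strictly beyond one of the two ends bounding the gap.\<close>
    have "flip H y \<notin> X"
      using JX[OF y] yD by (simp add: X_def parallel_flip flip_in)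
    then have "\<beta> \<noteq> m" "\<beta> \<noteq> p" using m p \<beta> by auto
    moreover have "\<beta> \<notin> {m<..r}" using nJ \<beta> by (auto simp: J_def)
    ultimately consider "\<beta> < m" | "p < \<beta>" using r by force
    note \<beta>_cases = this
    let ?q = "boundary_walk H {edge y}"
    have tr: "?q = rot H \<circ> transpose (f \<alpha>) (f \<beta>)" "?q = rot H \<circ> transpose (f \<beta>) (f \<alpha>)"
      using boundary_walk_single[OF yD] unfolding \<alpha>(3)[symmetric] \<beta>(2)[symmetric]
      by (simp_all only: transpose_commute[of y])
    have "\<not> parallel y (f m)" "\<not> parallel y (f p)" "parallel (f m) (f p)"
      using JX[OF y] yD m(2) p(2) parallel_sym parallel_trans unfolding X_def by blast+
    then have same: "orbit ?q (f m) = orbit ?q (f p)"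
      using yD fD by (intro same_side) auto
    have self: "z \<in> orbit ?q z" for z
      using boundary_walk_permutes(2)[OF H, of "{edge y}"] edge_in[OF yD]
      by (intro permutation_self_in_orbit) auto
    \<comment> \<open>\<open>arc_notin\<close> speaks of positions below \<open>card D\<close>, so
      position \<open>card D\<close> is replaced by 0.\<close>
    define p' where "p' = (if p = ?N then 0 else p)"
    have p': "f p' = f p" "p' < ?N" using p q fN by (auto simp: p'_def)
    \<comment> \<open>The arc between the positions \<open>\<alpha>\<close> and
      \<open>\<beta>\<close> of the ends of \<open>y\<close> is invariant under the walk and
      contains exactly one of the two ends bounding the gap.\<close>
    from \<beta>_cases show False
    proof cases
      case 1
      then have "?q z \<in> f ` {\<beta><..\<alpha>}" if "z \<in> f ` {\<beta><..\<alpha>}" for z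
        unfolding tr(2) o_apply using \<alpha>(1,2) r by (intro arc[OF _ _ that]) linarith+
      moreover have "f m \<in> f ` {\<beta><..\<alpha>}" using 1 \<alpha> by auto
      ultimately have "orbit ?q (f m) \<subseteq> f ` {\<beta><..\<alpha>}"
        by (intro orbit_subset_invariant)
      moreover have "f p' \<notin> f ` {\<beta><..\<alpha>}"
        using \<alpha> r p' by (intro notin) (auto simp: p'_def)
      ultimately show False
        using same self[of "f p"] unfolding p'(1) by blast
    next
      case 2
      then have "?q z \<in> f ` {\<alpha><..\<beta>}" if "z \<in> f ` {\<alpha><..\<beta>}" for z
        unfolding tr(1) o_apply using \<alpha>(2) \<beta>(1) r by (intro arc[OF _ _ that]) linarith+
      moreover have "f p \<in> f ` {\<alpha><..\<beta>}" using 2 \<alpha> r by auto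
      ultimately have "orbit ?q (f p) \<subseteq> f ` {\<alpha><..\<beta>}"
        by (intro orbit_subset_invariant)
      moreover have "f m \<notin> f ` {\<alpha><..\<beta>}"
        using \<alpha> \<beta> r by (intro notin) auto
      ultimately show False
        using same self[of "f m"] by blast
    qed
  qed
  have "J \<subseteq> D" using fD by (auto simp: J_def)
  moreover have "f r \<in> J" using r by (auto simp: J_def)
  moreover have "f m \<notin> J" unfolding J_def using r by (intro notin) auto
  moreover have "rot H (transpose (f r) (f m) d) \<in> J" if "d \<in> J" for d
    using arc[OF r(1,2), of d] that by (simp add: J_def transpose_commute)
  ultimately show ?thesis
    using closed fD by (intro exI[of _ J] exI[of _ "f r"] exI[of _ "f m"]) simp
qed

section \<open>A single class of edges: the bouquet of interlaced edges\<close>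

text \<open>The edge of \<open>a\<close> cuts the vertex circle into two arcs, and by
  \<open>interlaced_iff_parallel\<close> the ends of \<open>b\<close> lie on different ones. It
  remains to turn orbits into positions along the circle.\<close>

lemma interlacedI:
  assumes a: "a \<in> D" and b: "b \<in> D" and ne: "edge a \<noteq> edge b" and par: "parallel a b"
  shows "interlaced H (edge a) (edge b)"
proof -
  define f where "f t = (rot H ^^ t) a" for t
  let ?N = "card D" and ?q = "boundary_walk H {edge a}"
  note enum = orbit_enumerate[OF permutation_rot, of a, unfolded orbit_rot[OF a], folded f_def]
  have f0: "f 0 = a" by (simp add: f_def)
  obtain j where j: "j < ?N" "flip H a = f j"
    using a enum(2) flip_in by (metis imageE lessThan_iff)
  have "0 < j"
    using j f0 ribbon_graphD(6)[OF H a] by (cases j) auto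
  define K where "K = f ` {0<..j}"
  have q: "permutation ?q"
    using edge_in[OF a] by (intro boundary_walk_permutes(2)[OF H]) simp
  note self = permutation_self_in_orbit[OF q]
  have rotq: "?q = rot H \<circ> transpose a (f j)"
    using boundary_walk_single[OF a] unfolding j(2) .
  have inv: "?q z \<in> K" if "z \<in> K" for z
    using arc_invariant[OF enum(1)[unfolded f_def] \<open>0 < j\<close> j(1), of z] that
    unfolding rotq by (simp add: K_def f_def)
  have orbK: "orbit ?q z \<subseteq> K" if "z \<in> K" for z
    using that inv by (rule orbit_subset_invariant)
  have aK: "a \<notin> K"
    using arc_notin[OF enum(1)[unfolded f_def] j(1), of 0 0] j by (auto simp: K_def f_def)
  have faK: "flip H a \<in> K"
    using j \<open>0 < j\<close> by (auto simp: K_def)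
  have diff: "orbit ?q b \<noteq> orbit ?q (flip H b)"
    using interlaced_iff_parallel(1)[OF a b ne] par orbit_eq_iff[OF q] by blast
  have two: "card (orbit ?q ` D) = 2"
    using num_boundary_single[OF a] by (simp add: num_boundary_def iso)
  \<comment> \<open>There are only two orbits, and the ends of \<open>b\<close> occupy both.\<close>
  have three: False if "z \<in> D" "orbit ?q z \<noteq> orbit ?q b" "orbit ?q z \<noteq> orbit ?q (flip H b)" for z
  proof -
    have "card {orbit ?q z, orbit ?q b, orbit ?q (flip H b)} = 3"
      using that diff by simp
    moreover have "card {orbit ?q z, orbit ?q b, orbit ?q (flip H b)} \<le> card (orbit ?q ` D)"
      using that b finite_darts by (intro card_mono) (auto simp: flip_in)
    ultimately show False using two by simp
  qed
  \<comment> \<open>\<open>a\<close> lies outside the invariant set \<open>K\<close> and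
    \<open>flip H a\<close> inside it. Each shares its orbit with an end of \<open>b\<close>, so
    neither side is free of such ends.\<close>
  have "b \<in> K \<longleftrightarrow> flip H b \<notin> K"
    using three[of a] three[of "flip H a"] orbK[of b] orbK[of "flip H b"] orbK[of "flip H a"]
      self[of a] self[of b] self[of "flip H b"] aK faK a flip_in by blast
  then obtain b' where b': "b' \<in> edge b" "b' \<in> K" "flip H b' \<notin> K" "b' \<in> D"
    using b ribbon_graphD(4)[OF H] flip_in by (metis insertCI)
  then have "edge b' = edge b"
    using edge_flip[OF H, of b] by auto
  have "b' \<noteq> flip H a" "flip H b' \<noteq> a"
    using ne \<open>edge b' = edge b\<close> edge_flip[OF H, of a] edge_flip[OF H, of b'] by auto
  obtain i where i: "0 < i" "i \<le> j" "b' = f i"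
    using b'(2) by (auto simp: K_def)
  obtain k where k: "k < ?N" "flip H b' = f k"
    using b'(4) enum(2) flip_in by (metis imageE lessThan_iff)
  \<comment> \<open>\<open>K\<close> occupies positions 1 to \<open>j\<close> and position 0 is
    \<open>a\<close>, so the end outside \<open>K\<close> comes after
    \<open>flip H a\<close>.\<close>
  have "k \<noteq> 0" "k \<notin> {0<..j}"
    using k b' \<open>flip H b' \<noteq> a\<close> f0 by (auto simp: K_def)
  then have "j < k" by simp
  moreover have "i < j"
    using i j \<open>b' \<noteq> flip H a\<close> by (cases "i = j") auto
  ultimately show ?thesis
    unfolding interlaced_def orbit_rot[OF a]
    using b'(1) i j k orbit_rot[OF a]
    by (intro bexI[of _ a] bexI[of _ b'] exI[of _ i] exI[of _ j] exI[of _ k]) (auto simp: f_def)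
qed

text \<open>All edges lie beside the same two faces, so there are no others. With one vertex and two
  faces, parity makes the number of edges odd.\<close>

lemma is_B_if_all_parallel:
  assumes ne: "D \<noteq> {}" and par: "\<And>a b. a \<in> D \<Longrightarrow> b \<in> D \<Longrightarrow> parallel a b"
  shows "odd (card (edges H))" "is_B (card (edges H)) H"
proof -
  obtain a where a: "a \<in> D" using ne by blast
  have "face ` D = face ` edge a"
  proof
    show "face ` D \<subseteq> face ` edge a"
      using par[OF a] unfolding parallel_def by blast
    show "face ` edge a \<subseteq> face ` D"
      using a flip_in by auto
  qed
  moreover have "face a \<noteq> face (flip H a)"
    using face_flip[OF a] orbit_eq_iff[OF boundary_walk_permutes(2)[OF H subset_refl]] by blast
  ultimately have "num_boundary H (edges H) = 2"
    by (simp add: num_boundary_def iso)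
  then show "odd (card (edges H))"
    using num_boundary_parity[OF H subset_refl] one_vertex by simp
  have "num_vertices H = 1"
    using one_vertex by (simp add: num_vertices_def num_boundary_def boundary_walk_empty)
  moreover have "interlaced H e e'" if "e \<in> edges H" "e' \<in> edges H" "e \<noteq> e'" for e e'
    using that interlacedI par by (auto simp: edges_def)
  ultimately show "is_B (card (edges H)) H"
    using H by (auto simp: is_B_def)
qed

end

section \<open>Reduction of a join-prime graph to a balanced bouquet\<close>

theorem theorem3p1:
  fixes G :: "'d rgraph"
  assumes "ribbon_graph G"
    and "edges G \<noteq> {}"
    and "join_prime G"
    and "\<not> (\<exists>(n :: nat) (B :: 'd rgraph) A.
           odd n \<and> is_B n B \<and> A \<subseteq> edges B \<and> ribbon_iso G (partial_dual B A))"
  shows "\<exists>A A'. A \<subseteq> edges G \<and> A' \<subseteq> edges G \<and>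
           genus (partial_dual G A) \<noteq> genus (partial_dual G A')"
proof (rule ccontr)
  assume "\<not> ?thesis"
  then have genus_eq: "genus (partial_dual G A) = genus (partial_dual G {})"
    if "A \<subseteq> edges G" for A
    using that by blast
  note G = assms(1)
  have ne: "darts G \<noteq> {}"
    using assms(2) by (auto simp: edges_def)
  have "connected_rg G"
    using assms(3) by (simp add: join_prime_def)
  note one = ex_num_boundary_eq_1[OF G this ne]
  obtain A where A: "A \<subseteq> edges G" "num_boundary G A = 1"
    using one(2) by blast
  define H where "H = partial_dual G A"
  have H: "ribbon_graph H"
    unfolding H_def using G A(1) by (rule ribbon_graph_partial_dual)
  have edges: "edges H = edges G" and darts: "darts H = darts G" and flip: "flip H = flip G"
    and isoH: "isolated H = 0"
    using one(1) by (simp_all add: H_def edges_partial_dual) (simp_all add: partial_dual_def)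
  \<comment> \<open>Dualising by \<open>A\<close> twice is the identity. Once \<open>H\<close> is
    known to be a bouquet of interlaced edges, this exhibits \<open>G\<close> as its partial
    dual.\<close>
  have HA: "partial_dual H A = G"
    using partial_dual_partial_dual[OF G A(1) A(1)] by (simp add: H_def partial_dual_empty)
  \<comment> \<open>Partial duals of \<open>H\<close> are partial duals of \<open>G\<close> by
    symmetric differences, so they share the common genus.\<close>
  have const: "genus (partial_dual H B) = genus (partial_dual H {})" if B: "B \<subseteq> edges H" for B
  proof -
    have "sym_diff A B \<subseteq> edges G" "sym_diff A {} \<subseteq> edges G"
      using A(1) B edges by blast+
    then show ?thesis
      unfolding H_def using partial_dual_partial_dual[OF G A(1)] B genus_eq
      by (metis edges empty_subsetI)
  qed
  have "balanced_bouquet H (num_boundary H {} + num_boundary H (edges H))"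
  proof
    show "ribbon_graph H" "isolated H = 0" by fact+
    show "num_boundary H {} = 1"
      using boundary_walk_partial_dual[OF G A(1) empty_subsetI] A(2)
      by (simp add: num_boundary_def H_def) (simp add: partial_dual_def)
    fix B assume B: "B \<subseteq> edges H"
    then show "num_boundary H B + num_boundary H (edges H - B) =
        num_boundary H {} + num_boundary H (edges H)"
      using genus_partial_dual[OF H B] genus_partial_dual[OF H empty_subsetI] const[OF B] by simp
  qed
  then interpret balanced_bouquet H "num_boundary H {} + num_boundary H (edges H)" .
  \<comment> \<open>Two classes would split \<open>H\<close> along an arc, and the split transfers
    to \<open>G\<close>, against its join-primality.\<close>
  have "parallel a b" if ab: "a \<in> darts H" "b \<in> darts H" for a b
  proof (rule ccontr)
    assume "\<not> parallel a b"
    then obtain I d1 d2 where "I \<subseteq> darts H" "\<forall>d\<in>I. flip H d \<in> I" "d1 \<in> I" "d2 \<in> darts H"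
      "d2 \<notin> I" "\<forall>d\<in>I. rot H (transpose d1 d2 d) \<in> I"
      using ex_invariant_arc[OF ab] by blast
    then have "\<not> join_prime G"
      using not_join_prime_if_partial_dual_split[OF G A(1) one(1), of I d1 d2]
      unfolding darts flip by (auto simp: H_def)
    with assms(3) show False by blast
  qed
  then have "odd (card (edges H))" "is_B (card (edges H)) H"
    using is_B_if_all_parallel ne darts by simp_all
  moreover have "A \<subseteq> edges H" "ribbon_iso G (partial_dual H A)"
    using A(1) by (simp_all add: edges HA ribbon_iso_refl)
  ultimately show False
    using assms(4) by blast
qed

end
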